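(* Let $\mathcal{X}$ be a real Banach space, $\mathcal{C}\subset\mathcal{X}$ a closed pointed convex normal cone with nonempty interior $\mathcal{C}_0$, and $\mathbf{e}\in\mathcal{C}_0$ a fixed unit element. Let $T:\mathcal{X}\to\mathcal{X}$ be an abstract Markov operator, i.e. a bounded linear map with $T(\mathcal{C})\subset\mathcal{C}$ and $T(\mathbf{e})=\mathbf{e}$. Then $$\sup_{\substack{z\in\mathcal{X}\\ \omega(z/\mathbf{e})\neq 0}}\frac{\omega(T(z)/\mathbf{e})}{\omega(z/\mathbf{e})} =\sup_{\substack{\nu,\pi\in\mathcal{P}(\mathbf{e})\\ \nu\neq\pi}}\frac{\|T^\star(\nu-\pi)\|_T^\star}{\|\nu-\pi\|_T^\star} =\frac12\sup_{\substack{\nu,\pi\in\operatorname{extr}\mathcal{P}(\mathbf{e})\\ \nu\perp\pi}}\|T^\star(\nu)-T^\star(\pi)\|_T^\star$$ $$=1-\inf_{\substack{\nu,\pi\in\operatorname{extr}\mathcal{P}(\mathbf{e})\\ \nu\perp\pi}}\ \inf_{x\in[0,\mathbf{e}]}\Big(\langle\pi,T(x)\rangle+\langle\nu,T(\mathbf{e}-x)\rangle\Big).$$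
   Context: $\mathcal{X}$ is a nonzero real Banach space with norm $\|\cdot\|$ and dual $\mathcal{X}^\star$; $\langle q,x\rangle=q(x)$ for $q\in\mathcal{X}^\star$, $x\in\mathcal{X}$. The cone $\mathcal{C}$ satisfies $\alpha\mathcal{C}\subset\mathcal{C}$ for $\alpha\ge0$, $\mathcal{C}+\mathcal{C}\subset\mathcal{C}$, $\mathcal{C}\cap(-\mathcal{C})=\{0\}$; the order is $x\preceq y\iff y-x\in\mathcal{C}$. Normal means there is $K>0$ with $0\preceq x\preceq y\Rightarrow\|x\|\le K\|y\|$. Order interval: $[x,y]=\{z:x\preceq z\preceq y\}$. Hopf's oscillation: $\omega(x/\mathbf{e})=\inf\{\beta-\alpha:\alpha\mathbf{e}\preceq x\preceq\beta\mathbf{e}\}$. Thompson's norm: $\|x\|_T=\inf\{\alpha>0:-\alpha\mathbf{e}\preceq x\preceq\alpha\mathbf{e}\}$ (equivalent to $\|\cdot\|$ by normality). $\|\cdot\|_T^\star$ is its dual norm on $\mathcal{X}^\star$: $\|z\|_T^\star=\sup_{\|x\|_T=1}\langle z,x\rangle$. $T^\star:\mathcal{X}^\star\to\mathcal{X}^\star$ is the adjoint of $T$ (here the subscript $T$ in $\|\cdot\|_T$ stands for "Thompson" and has nothing to do with the operator $T$). Dual cone: $\mathcal{C}^\star=\{z\in\mathcal{X}^\star:\langle z,x\rangle\ge0\ \forall x\in\mathcal{C}\}$, which orders $\mathcal{X}^\star$ by $\mu\succeq\nu\iff\mu-\nu\in\mathcal{C}^\star$. Abstract simplex: $\mathcal{P}(\mathbf{e})=\{\mu\in\mathcal{C}^\star:\langle\mu,\mathbf{e}\rangle=1\}$.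 $\operatorname{extr}$ denotes the set of extreme points of a convex set. Disjointness: for $\nu,\pi\in\mathcal{P}(\mathbf{e})$, $\nu\perp\pi$ means that every $\mu\in\mathcal{P}(\mathbf{e})$ with $\mu\succeq\nu/2$ and $\mu\succeq\pi/2$ satisfies $\mu=(\nu+\pi)/2$. Convention: a supremum of nonnegative quantities over an empty set is $0$ (only relevant if $\dim\mathcal{X}=1$). *)

theory Defs
  imports "HOL-Analysis.Analysis"
begin

definition pointed_convex_cone :: "'a::real_vector set \<Rightarrow> bool" where
  "pointed_convex_cone C \<longleftrightarrow>
     (\<forall>\<alpha>\<ge>0. \<forall>x\<in>C. \<alpha> *\<^sub>R x \<in> C) \<and> (\<forall>x\<in>C. \<forall>y\<in>C. x + y \<in> C) \<and> C \<inter> uminus ` C = {0}"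

definition cone_le :: "'a::real_vector set \<Rightarrow> 'a \<Rightarrow> 'a \<Rightarrow> bool" where
  "cone_le C x y \<longleftrightarrow> y - x \<in> C"

definition normal_cone :: "'a::real_normed_vector set \<Rightarrow> bool" where
  "normal_cone C \<longleftrightarrow>
     (\<exists>K>0. \<forall>x y. cone_le C 0 x \<and> cone_le C x y \<longrightarrow> norm x \<le> K * norm y)"

definition order_interval :: "'a::real_vector set \<Rightarrow> 'a \<Rightarrow> 'a \<Rightarrow> 'a set" where
  "order_interval C x y = {z. cone_le C x z \<and> cone_le C z y}"

definition hopf_oscillation :: "'a::real_vector set \<Rightarrow> 'a \<Rightarrow> 'a \<Rightarrow> real" where
  "hopf_oscillation C e x =
     Inf {\<beta> - \<alpha> | \<alpha> \<beta>. cone_le C (\<alpha> *\<^sub>R e) x \<and> cone_le C x (\<beta> *\<^sub>R e)}"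

definition thompson_norm :: "'a::real_vector set \<Rightarrow> 'a \<Rightarrow> 'a \<Rightarrow> real" where
  "thompson_norm C e x =
     Inf {\<alpha>. \<alpha> > 0 \<and> cone_le C ((- \<alpha>) *\<^sub>R e) x \<and> cone_le C x (\<alpha> *\<^sub>R e)}"

text \<open>The topological dual of \<open>'a\<close> is the type \<open>'a \<Rightarrow>\<^sub>L real\<close>, the pairing being function application.\<close>

definition thompson_dual_norm ::
    "'a::real_normed_vector set \<Rightarrow> 'a \<Rightarrow> ('a \<Rightarrow>\<^sub>L real) \<Rightarrow> real" where
  "thompson_dual_norm C e z = (SUP x\<in>{x. thompson_norm C e x = 1}. blinfun_apply z x)"

definition dual_map ::
    "('a::real_normed_vector \<Rightarrow>\<^sub>L 'b::real_normed_vector) \<Rightarrow> ('b \<Rightarrow>\<^sub>L real) \<Rightarrow> ('a \<Rightarrow>\<^sub>L real)" where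
  "dual_map T z = z o\<^sub>L T"

definition dual_cone :: "'a::real_normed_vector set \<Rightarrow> ('a \<Rightarrow>\<^sub>L real) set" where
  "dual_cone C = {z. \<forall>x\<in>C. 0 \<le> blinfun_apply z x}"

definition abstract_simplex :: "'a::real_normed_vector set \<Rightarrow> 'a \<Rightarrow> ('a \<Rightarrow>\<^sub>L real) set" where
  "abstract_simplex C e = {\<mu> \<in> dual_cone C. blinfun_apply \<mu> e = 1}"

definition extreme_points :: "'a::real_vector set \<Rightarrow> 'a set" where
  "extreme_points S = {x. x extreme_point_of S}"

definition disjoint_in_simplex ::
    "'a::real_normed_vector set \<Rightarrow> 'a \<Rightarrow> ('a \<Rightarrow>\<^sub>L real) \<Rightarrow> ('a \<Rightarrow>\<^sub>L real) \<Rightarrow> bool" where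
  "disjoint_in_simplex C e \<nu> \<pi> \<longleftrightarrow>
     \<nu> \<in> abstract_simplex C e \<and> \<pi> \<in> abstract_simplex C e \<and>
     (\<forall>\<mu>\<in>abstract_simplex C e.
        cone_le (dual_cone C) ((1/2) *\<^sub>R \<nu>) \<mu> \<and> cone_le (dual_cone C) ((1/2) *\<^sub>R \<pi>) \<mu>
        \<longrightarrow> \<mu> = (1/2) *\<^sub>R (\<nu> + \<pi>))"

definition disjoint_extreme_pairs ::
    "'a::real_normed_vector set \<Rightarrow> 'a \<Rightarrow> (('a \<Rightarrow>\<^sub>L real) \<times> ('a \<Rightarrow>\<^sub>L real)) set" where
  "disjoint_extreme_pairs C e =
     {(\<nu>, \<pi>). \<nu> \<in> extreme_points (abstract_simplex C e) \<and>
              \<pi> \<in> extreme_points (abstract_simplex C e) \<and> disjoint_in_simplex C e \<nu> \<pi>}"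

definition abstract_markov_operator ::
    "'a::real_normed_vector set \<Rightarrow> 'a \<Rightarrow> ('a \<Rightarrow>\<^sub>L 'a) \<Rightarrow> bool" where
  "abstract_markov_operator C e T \<longleftrightarrow> blinfun_apply T ` C \<subseteq> C \<and> blinfun_apply T e = e"

text \<open>Suprema of nonnegative quantities, with value 0 on the empty set. In \<open>ereal\<close> the supremum of an
  empty set would be \<open>- \<infinity>\<close>; in \<open>real\<close> that of an unbounded set would be unspecified.\<close>

definition Sup_nonneg :: "ereal set \<Rightarrow> ereal" where
  "Sup_nonneg A = (if A = {} then 0 else Sup A)"

end

theory Submission
  imports Defs
begin

text \<open>Write \<open>upper x\<close> for the least \<open>\<beta>\<close> with \<open>x \<preceq> \<beta>e\<close>. This is a sublinear functional, and the abstract simplex is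
the set of linear functionals below it. The oscillation is \<open>\<omega>(x) = upper x + upper (- x)\<close>. Up to the
factor 2 it is the quotient of the Thompson norm by the line through \<open>e\<close>, and a difference of elements of
the simplex annihilates this line. This gives the basic estimate
\<open>\<langle>\<nu> - \<pi>, x\<rangle> \<le> \<parallel>\<nu> - \<pi>\<parallel> \<omega>(x) / 2\<close> (\<open>diff_le_dual_norm_hopf\<close>), the norm on the right being the dual Thompson
norm, which never exceeds 2 on such differences.

Call the first two suprema \<open>S1\<close> and \<open>S2\<close>, and let \<open>S3\<close> be the supremum over disjoint extreme pairs. The
first two equalities come from a cycle of inequalities. The bound \<open>S2 \<le> S1\<close> is the basic estimate at \<open>T x\<close>
combined with \<open>\<omega>(x) \<le> 2\<close> on the Thompson unit sphere. The bound \<open>S3/2 \<le> S2\<close> holds because dual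
distances in the simplex are at most 2. For \<open>S1 \<le> S3/2\<close> a disjoint extreme pair \<open>(\<nu>, \<pi>)\<close> with
\<open>\<langle>\<nu> - \<pi>, T z\<rangle> = \<omega>(T z)\<close> is needed; the basic estimate for the pair of images under the adjoint, which are
again in the simplex, then finishes the cycle.

Such a pair (\<open>disjoint_extreme_pair_attains_hopf\<close>) is found in two steps. By
\<open>extreme_support_functional\<close>, the linear functionals below the sublinear functional \<open>\<omega>\<close> have an extreme
element \<open>f\<close> with \<open>f (T z) = \<omega>(T z)\<close>. By a sandwich argument (\<open>linear_le_hopf_decomposition\<close>) this \<open>f\<close> is a
difference \<open>\<nu> - \<pi>\<close> of elements of the simplex, and extremality of \<open>f\<close> in the set of all such differences
makes \<open>\<nu>\<close> and \<open>\<pi>\<close> extreme and disjoint. The existence of \<open>f\<close> follows from Zorn's lemma for sublinear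
functionals that describe faces.

The last equality is an affine change of variable between the order intervals \<open>[- e, e]\<close> and \<open>[0, e]\<close>
(\<open>INF_order_interval_eq_dual_norm\<close>).\<close>

section \<open>Extreme linear functionals below a sublinear functional\<close>

definition sublinear :: "('a::real_vector \<Rightarrow> real) \<Rightarrow> bool" where
  "sublinear p \<longleftrightarrow> (\<forall>x y. p (x + y) \<le> p x + p y) \<and> (\<forall>t\<ge>0. \<forall>x. p (t *\<^sub>R x) = t * p x)"

text \<open>An inequality for positive scalars suffices: applied to \<open>t\<close> and to \<open>1 / t\<close> it gives homogeneity, and
applied at the origin with two different factors it forces \<open>p 0 = 0\<close>. Infima of homogeneous
expressions satisfy the inequality by inspection.\<close>

lemma sublinearI:
  assumes add: "\<And>x y. p (x + y) \<le> p x + p y"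
    and scale: "\<And>t x. t > 0 \<Longrightarrow> p (t *\<^sub>R x) \<le> t * p x"
  shows "sublinear p"
proof -
  have zero: "p 0 = 0"
    using scale[of 2 0] scale[of "1/2" 0] by simp
  have "p (t *\<^sub>R x) = t * p x" if "t \<ge> 0" for t x
  proof (cases "t = 0")
    case False
    then have t: "t > 0" using that by simp
    have "p x \<le> (1/t) * p (t *\<^sub>R x)"
      using scale[of "1/t" "t *\<^sub>R x"] t by simp
    then have "t * p x \<le> p (t *\<^sub>R x)"
      using t by (simp add: field_simps)
    then show ?thesis using scale[OF t, of x] by simp
  qed (simp add: zero)
  then show ?thesis using add by (simp add: sublinear_def)
qed

lemma sublinear_add: "sublinear p \<Longrightarrow> p (x + y) \<le> p x + p y"
  and sublinear_scale: "sublinear p \<Longrightarrow> t \<ge> 0 \<Longrightarrow> p (t *\<^sub>R x) = t * p x"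
  by (auto simp: sublinear_def)

lemma sublinear_zero: "sublinear p \<Longrightarrow> p 0 = 0"
  using sublinear_scale[of p 0 0] by simp

lemma sublinear_uminus: "sublinear p \<Longrightarrow> - p (- x) \<le> p x"
  using sublinear_add[of p x "- x"] sublinear_zero[of p] by simp

lemma sublinear_odd_imp_linear:
  assumes p: "sublinear p" and odd: "\<And>x. p (- x) \<le> - p x"
  shows "linear p"
proof -
  have minus: "p (- x) = - p x" for x
    using odd[of x] sublinear_uminus[OF p, of x] by simp
  have "p (x + y) = p x + p y" for x y
    using sublinear_add[OF p, of x y] sublinear_add[OF p, of "- x" "- y"]
      minus[of "x + y"] minus[of x] minus[of y] by simp
  moreover have "p (r *\<^sub>R x) = r *\<^sub>R p x" for r x
  proof (cases "r \<ge> 0")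
    case False
    then have "p ((- r) *\<^sub>R x) = (- r) * p x"
      by (intro sublinear_scale[OF p]) simp
    then show ?thesis using minus[of "r *\<^sub>R x"] by simp
  qed (simp add: sublinear_scale[OF p])
  ultimately show ?thesis by (intro linearI) auto
qed

lemma linear_le_linear_imp_eq:
  fixes f g :: "'a::real_vector \<Rightarrow> real"
  assumes "linear f" "linear g" "\<And>x. f x \<le> g x"
  shows "f = g"
proof
  fix x show "f x = g x"
    using assms(3)[of x] assms(3)[of "- x"] by (simp add: linear_neg assms(1,2))
qed

text \<open>A sublinear \<open>q \<le> p\<close> stands for the set of linear functionals below \<open>q\<close>, a convex subset of the set of
those below \<open>p\<close>; the last clause says that this subset is a face. Working with support functions
in place of the sets of functionals keeps the algebraic dual and its topology out of the argument.\<close>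

definition face_functional ::
    "('a::real_vector \<Rightarrow> real) \<Rightarrow> ('a \<Rightarrow> real) \<Rightarrow> bool" where
  "face_functional p q \<longleftrightarrow> sublinear q \<and> q \<le> p \<and>
     (\<forall>f g u. linear f \<and> linear g \<and> f \<le> p \<and> g \<le> p \<and> 0 < u \<and> u < 1
        \<and> (\<forall>x. (1 - u) * f x + u * g x \<le> q x) \<longrightarrow> f \<le> q \<and> g \<le> q)"

lemma face_functional_refl: "sublinear p \<Longrightarrow> face_functional p p"
  by (simp add: face_functional_def)

text \<open>The support function of the functionals \<open>f \<le> q\<close> with \<open>f y = q y\<close>: for such \<open>f\<close>, the value
\<open>f x = f (x + t *\<^sub>R y) - t * f y\<close> is at most \<open>q (x + t *\<^sub>R y) - t * q y\<close> for every \<open>t \<ge> 0\<close>.\<close>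

definition exposed_functional ::
    "('a::real_vector \<Rightarrow> real) \<Rightarrow> 'a \<Rightarrow> 'a \<Rightarrow> real" where
  "exposed_functional q y x = (INF t\<in>{0..}. q (x + t *\<^sub>R y) - t * q y)"

lemma exposed_functional_le:
  assumes q: "sublinear q" and "t \<ge> 0"
  shows "exposed_functional q y x \<le> q (x + t *\<^sub>R y) - t * q y"
  unfolding exposed_functional_def
proof (rule cINF_lower)
  have "- q (- x) \<le> q (x + s *\<^sub>R y) - s * q y" if "s \<ge> 0" for s
    using sublinear_add[OF q, of "x + s *\<^sub>R y" "- x"] sublinear_scale[OF q that, of y] by simp
  then show "bdd_below ((\<lambda>t. q (x + t *\<^sub>R y) - t * q y) ` {0..})"
    by (intro bdd_belowI[where m = "- q (- x)"]) auto
qed (use assms in auto)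

lemma exposed_functional_greatest:
  assumes "\<And>t. t \<ge> 0 \<Longrightarrow> m \<le> q (x + t *\<^sub>R y) - t * q y"
  shows "m \<le> exposed_functional q y x"
  unfolding exposed_functional_def by (rule cINF_greatest) (use assms in auto)

lemma sublinear_exposed_functional:
  assumes q: "sublinear q"
  shows "sublinear (exposed_functional q y)" (is "sublinear ?r")
proof (rule sublinearI)
  fix a b :: 'a
  have "?r (a + b) - (q (b + t *\<^sub>R y) - t * q y) \<le> q (a + s *\<^sub>R y) - s * q y"
    if "s \<ge> 0" "t \<ge> 0" for s t
    using exposed_functional_le[OF q, of "s + t" y "a + b"] that
      sublinear_add[OF q, of "a + s *\<^sub>R y" "b + t *\<^sub>R y"]
    by (simp add: algebra_simps)
  then have "?r (a + b) - (q (b + t *\<^sub>R y) - t * q y) \<le> ?r a" if "t \<ge> 0" for t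
    using that by (intro exposed_functional_greatest) auto
  then have "?r (a + b) - ?r a \<le> ?r b"
    by (intro exposed_functional_greatest) (auto simp: algebra_simps)
  then show "?r (a + b) \<le> ?r a + ?r b" by simp
next
  fix s :: real and x :: 'a assume s: "s > 0"
  have "?r (s *\<^sub>R x) / s \<le> q (x + t *\<^sub>R y) - t * q y" if "t \<ge> 0" for t
    using exposed_functional_le[OF q, of "s * t" y "s *\<^sub>R x"] that s
      sublinear_scale[OF q, of s "x + t *\<^sub>R y"]
    by (simp add: field_simps scaleR_add_right)
  then have "?r (s *\<^sub>R x) / s \<le> ?r x"
    by (rule exposed_functional_greatest)
  then show "?r (s *\<^sub>R x) \<le> s * ?r x" using s by (simp add: field_simps)
qed

lemma exposed_functional_at_neg:
  assumes q: "sublinear q"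
  shows "exposed_functional q y (- y) \<le> - q y"
  using exposed_functional_le[OF q, of 1 y "- y"] sublinear_zero[OF q] by simp

text \<open>Faces of faces are faces. If a proper convex combination of \<open>f\<close> and \<open>g\<close> lies below the exposed
functional, it takes the maximal value \<open>q y\<close> at \<open>y\<close>; neither \<open>f\<close> nor \<open>g\<close> exceeds \<open>q y\<close> there, so both
attain it.\<close>

lemma face_functional_exposed:
  assumes face: "face_functional p q"
  shows "face_functional p (exposed_functional q y)"
proof -
  let ?r = "exposed_functional q y"
  have q: "sublinear q" and qp: "q \<le> p" using face by (auto simp: face_functional_def)
  have rq: "?r \<le> q"
    using exposed_functional_le[OF q, of 0] by (simp add: le_fun_def)
  have "f \<le> ?r \<and> g \<le> ?r"
    if f: "linear f" "f \<le> p" and g: "linear g" "g \<le> p" and u: "0 < u" "u < 1"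
      and fg: "\<And>x. (1 - u) * f x + u * g x \<le> ?r x" for f g u
  proof -
    have "(1 - u) * f x + u * g x \<le> q x" for x
      using fg[of x] rq by (meson le_funD order_trans)
    then have fq: "f \<le> q" and gq: "g \<le> q"
      using face f g u unfolding face_functional_def by blast+
    have "(1 - u) * f (- y) + u * g (- y) \<le> - q y"
      using fg[of "- y"] exposed_functional_at_neg[OF q, of y] by linarith
    then have sum: "(1 - u) * (q y - f y) + u * (q y - g y) \<le> 0"
      by (simp add: linear_neg f g algebra_simps)
    have "0 \<le> (1 - u) * (q y - f y)" "0 \<le> u * (q y - g y)"
      using u le_funD[OF fq, of y] le_funD[OF gq, of y] by auto
    then have "(1 - u) * (q y - f y) = 0" "u * (q y - g y) = 0" using sum by linarith+
    then have eq: "f y = q y" "g y = q y" using u by auto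
    have "h \<le> ?r" if h: "linear h" "h \<le> q" "h y = q y" for h
    proof (rule le_funI, rule exposed_functional_greatest)
      fix x and t :: real
      show "h x \<le> q (x + t *\<^sub>R y) - t * q y"
        using le_funD[OF h(2), of "x + t *\<^sub>R y"] h by (simp add: linear_add linear_scale)
    qed
    then show ?thesis using f g fq gq eq by blast
  qed
  then show ?thesis
    using sublinear_exposed_functional[OF q] rq qp
    unfolding face_functional_def by (meson order_trans)
qed

text \<open>The pointwise infimum works: it is bounded below by \<open>- p (- x)\<close>, and it is subadditive because two
members of a chain can be replaced by the smaller one. This replaces the compactness argument that
a decreasing family of nonempty closed faces has nonempty intersection.\<close>

lemma face_functional_chain_lower_bound:
  assumes K: "K \<noteq> {}" "\<And>q. q \<in> K \<Longrightarrow> face_functional p q"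
    and chain: "\<And>q r. q \<in> K \<Longrightarrow> r \<in> K \<Longrightarrow> q \<le> r \<or> r \<le> q"
  shows "\<exists>r. face_functional p r \<and> (\<forall>q\<in>K. r \<le> q)"
proof -
  define r where "r = (\<lambda>x. INF q\<in>K. q x)"
  have sub: "sublinear q" and qp: "q \<le> p" if "q \<in> K" for q
    using K(2)[OF that] by (auto simp: face_functional_def)
  have low: "r x \<le> q x" if "q \<in> K" for q x
    unfolding r_def
  proof (rule cINF_lower)
    have "- p (- x) \<le> q x" if "q \<in> K" for q
      using sublinear_uminus[OF sub[OF that], of x] le_funD[OF qp[OF that], of "- x"] by linarith
    then show "bdd_below ((\<lambda>q. q x) ` K)"
      by (intro bdd_belowI[where m = "- p (- x)"]) auto
  qed (rule that)
  have great: "m \<le> r x" if "\<And>q. q \<in> K \<Longrightarrow> m \<le> q x" for m x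
    unfolding r_def by (rule cINF_greatest) (use that K in auto)
  have "sublinear r"
  proof (rule sublinearI)
    fix x y
    have "r (x + y) - q2 y \<le> q1 x" if q12: "q1 \<in> K" "q2 \<in> K" for q1 q2
    proof -
      obtain q where q: "q \<in> K" "q \<le> q1" "q \<le> q2"
        using chain[OF q12] q12 by (metis order_refl)
      then show ?thesis
        using low[OF q(1), of "x + y"] sublinear_add[OF sub[OF q(1)], of x y]
          le_funD[OF q(2), of x] le_funD[OF q(3), of y] by linarith
    qed
    then have "r (x + y) - q2 y \<le> r x" if "q2 \<in> K" for q2
      using that by (intro great) auto
    then have "r (x + y) - r x \<le> r y"
      by (intro great) (simp add: algebra_simps)
    then show "r (x + y) \<le> r x + r y" by simp
  next
    fix t :: real and x assume t: "t > 0"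
    have "r (t *\<^sub>R x) / t \<le> q x" if "q \<in> K" for q
      using low[OF that, of "t *\<^sub>R x"] sublinear_scale[OF sub[OF that], of t x] t
      by (simp add: field_simps)
    then have "r (t *\<^sub>R x) / t \<le> r x" by (rule great)
    then show "r (t *\<^sub>R x) \<le> t * r x" using t by (simp add: field_simps)
  qed
  moreover have "r \<le> p"
    using K(1) low qp by (meson all_not_in_conv le_funD le_funI order_trans)
  moreover have "f \<le> r \<and> g \<le> r"
    if fg: "linear f" "linear g" "f \<le> p" "g \<le> p" "0 < u" "u < 1"
      and le: "\<forall>x. (1 - u) * f x + u * g x \<le> r x" for f g u
  proof -
    have "f \<le> q \<and> g \<le> q" if q: "q \<in> K" for q
    proof -
      have "\<forall>x. (1 - u) * f x + u * g x \<le> q x"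
        using le low[OF q] by (meson order_trans)
      then show ?thesis using K(2)[OF q] fg unfolding face_functional_def by blast
    qed
    then show ?thesis by (auto intro!: le_funI great dest: le_funD)
  qed
  ultimately have "face_functional p r" unfolding face_functional_def by blast
  then show ?thesis using low by (auto simp: le_fun_def)
qed

text \<open>The theorems of Hahn--Banach and Krein--Milman in one statement: the maximum of evaluation at \<open>y\<close>
over the linear functionals below \<open>p\<close> is \<open>p y\<close>, and it is attained at an extreme point of this set.
A minimal face functional \<open>f\<close> below the one exposed by \<open>y\<close> coincides with every face functional that it
exposes itself, hence satisfies \<open>f (- x) \<le> - f x\<close> for all \<open>x\<close>. So it is linear, and the face it
describes is a single point.\<close>

theorem extreme_support_functional:
  assumes p: "sublinear p"
  obtains f where "linear f" "f \<le> p" "f y = p y"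
    "\<And>g h u. \<lbrakk>linear g; linear h; g \<le> p; h \<le> p; 0 < u; u < 1;
        \<And>x. f x = (1 - u) * g x + u * h x\<rbrakk> \<Longrightarrow> g = f"
proof -
  let ?A = "{q. face_functional p q \<and> q \<le> exposed_functional p y}"
  let ?R = "relation_of (\<lambda>q r. r \<le> q) ?A"
  have start: "exposed_functional p y \<in> ?A"
    using face_functional_exposed[OF face_functional_refl[OF p]] by simp
  have "\<exists>m\<in>?A. \<forall>a\<in>?A. a \<le> m \<longrightarrow> a = m"
  proof (rule predicate_Zorn)
    show "partial_order_on ?A ?R"
      by (rule partial_order_on_relation_ofI) auto
  next
    fix K assume K: "K \<in> Chains ?R"
    show "\<exists>u\<in>?A. \<forall>a\<in>K. u \<le> a"
    proof (cases "K = {}")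
      case False
      have KA: "K \<subseteq> ?A"
        using K by (auto simp: Chains_def relation_of_def)
      have "\<exists>r. face_functional p r \<and> (\<forall>q\<in>K. r \<le> q)"
        using K KA False
        by (intro face_functional_chain_lower_bound) (auto simp: Chains_def relation_of_def)
      then obtain r where r: "face_functional p r" "\<forall>q\<in>K. r \<le> q" by blast
      then have "r \<le> exposed_functional p y" using KA False by (blast intro: order_trans)
      then show ?thesis using r by blast
    qed (use start in blast)
  qed
  then obtain f where f: "face_functional p f" "f \<le> exposed_functional p y"
    and min: "\<And>a. a \<in> ?A \<Longrightarrow> a \<le> f \<Longrightarrow> a = f" by blast
  have sub: "sublinear f" and fp: "f \<le> p" using f by (auto simp: face_functional_def)
  have "f (- x) \<le> - f x" for x
  proof -
    have le: "exposed_functional f x \<le> f"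
      using exposed_functional_le[OF sub, of 0] by (simp add: le_fun_def)
    then have "exposed_functional f x = f"
      using face_functional_exposed[OF f(1)] f(2) by (intro min) auto
    then show ?thesis using exposed_functional_at_neg[OF sub, of x] by simp
  qed
  then have lin: "linear f" by (rule sublinear_odd_imp_linear[OF sub])
  have "f (- y) \<le> - p y"
    using le_funD[OF f(2), of "- y"] exposed_functional_at_neg[OF p, of y] by linarith
  then have val: "f y = p y"
    using le_funD[OF fp, of y] by (simp add: linear_neg[OF lin])
  have "g = f" if gh: "linear g" "linear h" "g \<le> p" "h \<le> p" "0 < u" "u < 1"
      "\<And>x. f x = (1 - u) * g x + u * h x" for g h u
  proof -
    have "g \<le> f"
      using f(1) gh unfolding face_functional_def by (metis order_refl)
    then show ?thesis using linear_le_linear_imp_eq[OF gh(1) lin] by (simp add: le_fun_def)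
  qed
  then show ?thesis using that lin fp val by blast
qed

text \<open>The infimal convolution of \<open>p\<close> and \<open>q\<close> lies below both, and the hypothesis keeps it finite; a linear
functional below it exists by Hahn--Banach.\<close>

lemma sublinear_sandwich:
  assumes p: "sublinear p" and q: "sublinear q" and pq: "\<And>x. 0 \<le> p x + q (- x)"
  obtains g where "linear g" "g \<le> p" "g \<le> q"
proof -
  define r where "r = (\<lambda>x. INF u. p u + q (x - u))"
  have "- p (- x) \<le> p u + q (x - u)" for x u
    using sublinear_add[OF p, of u "- x"] pq[of "u - x"] by simp
  then have bdd: "bdd_below (range (\<lambda>u. p u + q (x - u)))" for x
    by (intro bdd_belowI[where m = "- p (- x)"]) auto
  have low: "r x \<le> p u + q (x - u)" for x u
    unfolding r_def by (rule cINF_lower[OF bdd]) simp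
  have great: "m \<le> r x" if "\<And>u. m \<le> p u + q (x - u)" for m x
    unfolding r_def by (rule cINF_greatest) (use that in auto)
  have "sublinear r"
  proof (rule sublinearI)
    fix x y
    have "r (x + y) - (p v + q (y - v)) \<le> p u + q (x - u)" for u v
      using low[of "x + y" "u + v"] sublinear_add[OF p, of u v]
        sublinear_add[OF q, of "x - u" "y - v"] by (simp add: algebra_simps)
    then have "r (x + y) - (p v + q (y - v)) \<le> r x" for v by (rule great)
    then have "r (x + y) - r x \<le> r y" by (intro great) (simp add: algebra_simps)
    then show "r (x + y) \<le> r x + r y" by simp
  next
    fix t :: real and x assume t: "t > 0"
    have "r (t *\<^sub>R x) / t \<le> p u + q (x - u)" for u
      using low[of "t *\<^sub>R x" "t *\<^sub>R u"] t sublinear_scale[OF p, of t u]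
        sublinear_scale[OF q, of t "x - u"]
      by (simp add: field_simps scaleR_diff_right)
    then have "r (t *\<^sub>R x) / t \<le> r x" by (rule great)
    then show "r (t *\<^sub>R x) \<le> t * r x" using t by (simp add: field_simps)
  qed
  then obtain g where g: "linear g" "g \<le> r"
    using extreme_support_functional by blast
  have "r \<le> p" using low[of x x for x] sublinear_zero[OF q] by (simp add: le_fun_def)
  moreover have "r \<le> q" using low[of x 0 for x] sublinear_zero[OF p] by (simp add: le_fun_def)
  ultimately show ?thesis using that g by (meson order_trans)
qed

section \<open>The order unit functional, the oscillation and the Thompson norm\<close>

locale order_unit_cone =
  fixes C :: "'a::real_normed_vector set" and e :: 'a
  assumes cone: "pointed_convex_cone C" and closed: "closed C"
    and unit: "e \<in> interior C" and unit_nonzero: "e \<noteq> 0"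
begin

lemma cone_add: "x \<in> C \<Longrightarrow> y \<in> C \<Longrightarrow> x + y \<in> C"
  and cone_scale: "\<alpha> \<ge> 0 \<Longrightarrow> x \<in> C \<Longrightarrow> \<alpha> *\<^sub>R x \<in> C"
  and cone_pointed: "x \<in> C \<Longrightarrow> - x \<in> C \<Longrightarrow> x = 0"
proof -
  show "x \<in> C \<Longrightarrow> - x \<in> C \<Longrightarrow> x = 0"
    using cone unfolding pointed_convex_cone_def by (metis IntI imageI minus_minus singletonD)
qed (use cone in \<open>auto simp: pointed_convex_cone_def\<close>)

lemma unit_in_cone: "e \<in> C"
  using unit interior_subset by blast

lemma scaled_unit_in_cone_iff: "\<beta> *\<^sub>R e \<in> C \<longleftrightarrow> 0 \<le> \<beta>"
proof
  assume "\<beta> *\<^sub>R e \<in> C"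
  then have "- e \<in> C" if "\<beta> < 0"
    using cone_scale[of "- 1 / \<beta>" "\<beta> *\<^sub>R e"] that by (simp add: divide_nonpos_neg)
  then show "0 \<le> \<beta>" using cone_pointed unit_in_cone unit_nonzero by force
qed (simp add: cone_scale unit_in_cone)

text \<open>An interior point of the cone is an order unit, with a bound proportional to the norm. This is the
source of the finiteness of \<open>upper\<close> and of the continuity of every linear functional below it.\<close>

lemma order_unit_bound:
  obtains K where "K > 0" "\<And>x. (K * norm x) *\<^sub>R e - x \<in> C"
proof -
  obtain r where r: "r > 0" "cball e r \<subseteq> C"
    using unit mem_interior_cball by blast
  have "(1 / r * norm x) *\<^sub>R e - x \<in> C" for x
  proof (cases "x = 0")
    case False
    then have "e - (r / norm x) *\<^sub>R x \<in> C"
      using r by (intro subsetD[OF r(2)]) (simp add: dist_norm)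
    then have "(norm x / r) *\<^sub>R (e - (r / norm x) *\<^sub>R x) \<in> C"
      using r by (intro cone_scale) auto
    then show ?thesis using False r by (simp add: scaleR_diff_right)
  qed (use scaled_unit_in_cone_iff[of 0] in simp)
  then show ?thesis using that[of "1 / r"] r by simp
qed

text \<open>The sublinear functional from which the other notions derive. It is the support function of the
abstract simplex, the oscillation is the sum of its values at \<open>x\<close> and \<open>- x\<close>, and the Thompson norm is
their maximum.\<close>

definition upper :: "'a \<Rightarrow> real" where
  "upper x = Inf {\<beta>. \<beta> *\<^sub>R e - x \<in> C}"

text \<open>The infimum is attained, since the cone is closed.\<close>

lemma upper_le_iff: "upper x \<le> \<beta> \<longleftrightarrow> \<beta> *\<^sub>R e - x \<in> C"
proof -
  let ?S = "{\<beta>. \<beta> *\<^sub>R e - x \<in> C}"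
  obtain K where K: "\<And>x. (K * norm x) *\<^sub>R e - x \<in> C" using order_unit_bound by blast
  have "- (K * norm x) \<le> \<beta>" if "\<beta> \<in> ?S" for \<beta>
    using cone_add[OF K[of "- x"], of "\<beta> *\<^sub>R e - x"] that scaled_unit_in_cone_iff[of "K * norm x + \<beta>"]
    by (simp add: scaleR_add_left)
  then have bdd: "bdd_below ?S" by (intro bdd_belowI[where m = "- (K * norm x)"]) auto
  have "closed ((\<lambda>\<beta>. \<beta> *\<^sub>R e - x) -` C)"
    by (intro closed_vimage closed continuous_intros)
  then have "closed ?S" by (simp add: vimage_def)
  then have mem: "upper x \<in> ?S"
    unfolding upper_def using closed_contains_Inf[OF _ bdd] K by blast
  show ?thesis
  proof
    assume "upper x \<le> \<beta>"
    then have "(\<beta> - upper x) *\<^sub>R e \<in> C" by (simp add: scaled_unit_in_cone_iff)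
    then show "\<beta> *\<^sub>R e - x \<in> C"
      using cone_add[of "(\<beta> - upper x) *\<^sub>R e" "upper x *\<^sub>R e - x"] mem
      by (simp add: scaleR_diff_left)
  next
    assume "\<beta> *\<^sub>R e - x \<in> C"
    then show "upper x \<le> \<beta>" unfolding upper_def by (intro cInf_lower bdd) simp
  qed
qed

lemma upper_in_cone: "upper x *\<^sub>R e - x \<in> C"
  using upper_le_iff[of x "upper x"] by simp

lemma sublinear_upper: "sublinear upper"
proof (rule sublinearI)
  show "upper (x + y) \<le> upper x + upper y" for x y
    using cone_add[OF upper_in_cone[of x] upper_in_cone[of y]]
    by (simp add: upper_le_iff algebra_simps)
  show "upper (t *\<^sub>R x) \<le> t * upper x" if "t > 0" for t x
    using cone_scale[OF _ upper_in_cone[of x], of t] that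
    by (simp add: upper_le_iff scaleR_diff_right)
qed

lemma upper_scaled_unit: "upper (t *\<^sub>R e) = t"
proof (rule antisym)
  show "upper (t *\<^sub>R e) \<le> t" using scaled_unit_in_cone_iff[of 0] by (simp add: upper_le_iff)
  show "t \<le> upper (t *\<^sub>R e)"
    using upper_in_cone[of "t *\<^sub>R e"] scaled_unit_in_cone_iff[of "upper (t *\<^sub>R e) - t"]
    by (simp add: scaleR_diff_left)
qed

lemma cone_iff_upper: "x \<in> C \<longleftrightarrow> upper (- x) \<le> 0"
  by (simp add: upper_le_iff)

lemma upper_shift: "upper (x - t *\<^sub>R e) = upper x - t"
proof (rule antisym)
  show "upper (x - t *\<^sub>R e) \<le> upper x - t"
    using upper_in_cone[of x] by (simp add: upper_le_iff scaleR_diff_left)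
  have "upper x \<le> upper (x - t *\<^sub>R e) + t"
    using upper_in_cone[of "x - t *\<^sub>R e"] by (simp add: upper_le_iff algebra_simps)
  then show "upper x - t \<le> upper (x - t *\<^sub>R e)" by simp
qed

lemma upper_pm_nonneg: "0 \<le> upper x + upper (- x)"
  using sublinear_uminus[OF sublinear_upper, of x] by simp

lemma cone_le_scaled_unit_iff:
  "cone_le C x (\<beta> *\<^sub>R e) \<longleftrightarrow> upper x \<le> \<beta>"
  "cone_le C (\<alpha> *\<^sub>R e) x \<longleftrightarrow> upper (- x) \<le> - \<alpha>"
  by (simp_all add: cone_le_def upper_le_iff)

lemma hopf_oscillation_eq: "hopf_oscillation C e x = upper x + upper (- x)"
  unfolding hopf_oscillation_def cone_le_scaled_unit_iff
proof (rule cInf_eq_minimum)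
  show "upper x + upper (- x) \<in> {\<beta> - \<alpha> |\<alpha> \<beta>. upper (- x) \<le> - \<alpha> \<and> upper x \<le> \<beta>}"
    by (rule CollectI, rule exI[of _ "- upper (- x)"], rule exI[of _ "upper x"]) simp
qed auto

lemma thompson_norm_eq: "thompson_norm C e x = max (upper x) (upper (- x))"
proof -
  let ?m = "max (upper x) (upper (- x))"
  have m: "0 \<le> ?m" using upper_pm_nonneg[of x] by linarith
  have "{\<alpha>. \<alpha> > 0 \<and> cone_le C ((- \<alpha>) *\<^sub>R e) x \<and> cone_le C x (\<alpha> *\<^sub>R e)} =
      (if ?m = 0 then {0<..} else {?m..})"
    using m unfolding cone_le_scaled_unit_iff by auto
  then show ?thesis by (simp add: thompson_norm_def)
qed

lemma sublinear_hopf: "sublinear (hopf_oscillation C e)"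
proof (rule sublinearI)
  show "hopf_oscillation C e (x + y) \<le> hopf_oscillation C e x + hopf_oscillation C e y" for x y
    using sublinear_add[OF sublinear_upper, of x y] sublinear_add[OF sublinear_upper, of "- x" "- y"]
    by (simp add: hopf_oscillation_eq)
  show "hopf_oscillation C e (t *\<^sub>R x) \<le> t * hopf_oscillation C e x" if "t > 0" for t x
    using sublinear_scale[OF sublinear_upper, of t x] sublinear_scale[OF sublinear_upper, of t "- x"] that
    by (simp add: hopf_oscillation_eq algebra_simps)
qed

lemma hopf_nonneg: "0 \<le> hopf_oscillation C e x"
  by (simp add: hopf_oscillation_eq upper_pm_nonneg)

lemma hopf_le_thompson: "hopf_oscillation C e x \<le> 2 * thompson_norm C e x"
  unfolding hopf_oscillation_eq thompson_norm_eq by linarith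

text \<open>The oscillation is a seminorm whose kernel is the line through the unit.\<close>

lemma hopf_zero_imp_scaled_unit:
  assumes "hopf_oscillation C e x = 0"
  shows "x = upper x *\<^sub>R e"
proof -
  have "upper (- x) = - upper x" using assms by (simp add: hopf_oscillation_eq)
  then have "x - upper x *\<^sub>R e \<in> C" using upper_in_cone[of "- x"] by simp
  then show ?thesis using cone_pointed[OF upper_in_cone[of x]] by simp
qed

lemma hopf_scaled_unit: "hopf_oscillation C e (t *\<^sub>R e) = 0"
  using upper_scaled_unit[of t] upper_scaled_unit[of "- t"] by (simp add: hopf_oscillation_eq)

lemma thompson_norm_unit: "thompson_norm C e e = 1"
  using upper_scaled_unit[of 1] upper_scaled_unit[of "- 1"] by (simp add: thompson_norm_eq)

lemma thompson_norm_scale: "t \<ge> 0 \<Longrightarrow> thompson_norm C e (t *\<^sub>R x) = t * thompson_norm C e x"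
  using sublinear_scale[OF sublinear_upper, of t x] sublinear_scale[OF sublinear_upper, of t "- x"]
  by (simp add: thompson_norm_eq max_mult_distrib_left)

lemma thompson_norm_nonneg: "0 \<le> thompson_norm C e x"
  using upper_pm_nonneg[of x] unfolding thompson_norm_eq by linarith

lemma thompson_norm_zero_imp:
  assumes "thompson_norm C e x = 0"
  shows "x = 0"
proof -
  have "upper x \<le> 0" "upper (- x) \<le> 0" using assms by (auto simp: thompson_norm_eq)
  then show ?thesis using cone_iff_upper[of x] cone_iff_upper[of "- x"] cone_pointed by simp
qed

section \<open>The abstract simplex\<close>

text \<open>Since \<open>upper x *\<^sub>R e - x\<close> lies in the cone, positivity and normalization bound \<open>\<mu> x\<close> by \<open>upper x\<close>. Conversely
positivity is the bound at \<open>- x\<close> for \<open>x\<close> in the cone, and normalization follows from the bounds at \<open>e\<close> and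
\<open>- e\<close>.\<close>

lemma simplex_iff_le_upper:
  "\<mu> \<in> abstract_simplex C e \<longleftrightarrow> blinfun_apply \<mu> \<le> upper"
proof
  assume \<mu>: "\<mu> \<in> abstract_simplex C e"
  show "blinfun_apply \<mu> \<le> upper"
  proof (rule le_funI)
    fix x
    have "0 \<le> \<mu> (upper x *\<^sub>R e - x)"
      using \<mu> upper_in_cone[of x] by (auto simp: abstract_simplex_def dual_cone_def)
    then show "\<mu> x \<le> upper x"
      using \<mu> by (simp add: abstract_simplex_def blinfun.diff_right blinfun.scaleR_right)
  qed
next
  assume le: "blinfun_apply \<mu> \<le> upper"
  have "0 \<le> \<mu> x" if "x \<in> C" for x
    using le_funD[OF le, of "- x"] that cone_iff_upper[of x] by (simp add: blinfun.minus_right)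
  moreover have "\<mu> e = 1"
    using le_funD[OF le, of e] le_funD[OF le, of "- e"] upper_scaled_unit[of 1] upper_scaled_unit[of "- 1"]
    by (simp add: blinfun.minus_right)
  ultimately show "\<mu> \<in> abstract_simplex C e" by (simp add: abstract_simplex_def dual_cone_def)
qed

lemma simplex_le_upper: "\<mu> \<in> abstract_simplex C e \<Longrightarrow> \<mu> x \<le> upper x"
  by (simp add: simplex_iff_le_upper le_fun_def)

lemma simplex_unit: "\<mu> \<in> abstract_simplex C e \<Longrightarrow> \<mu> e = 1"
  by (simp add: abstract_simplex_def)

lemma linear_le_upper_in_simplex:
  assumes f: "linear f" "f \<le> upper"
  obtains \<mu> where "\<mu> \<in> abstract_simplex C e" "blinfun_apply \<mu> = f"
proof -
  obtain K where K: "\<And>x. (K * norm x) *\<^sub>R e - x \<in> C" using order_unit_bound by blast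
  have "f x \<le> K * norm x" for x
    using le_funD[OF f(2), of x] upper_le_iff[of x "K * norm x"] K[of x] by simp
  from this[of x for x] this[of "- x" for x] have "\<bar>f x\<bar> \<le> norm x * K" for x
    by (simp add: linear_neg[OF f(1)] abs_le_iff mult.commute minus_le_iff)
  then have "bounded_linear f"
    using f(1) by (intro bounded_linear_intro[where K = K]) (auto simp: linear_add linear_scale)
  then have "blinfun_apply (Blinfun f) = f" by (rule bounded_linear_Blinfun_apply)
  then show ?thesis using that[of "Blinfun f"] f by (simp add: simplex_iff_le_upper)
qed

lemma simplex_diff_le_hopf:
  assumes "\<nu> \<in> abstract_simplex C e" "\<pi> \<in> abstract_simplex C e"
  shows "\<nu> x - \<pi> x \<le> hopf_oscillation C e x"
  using simplex_le_upper[OF assms(1), of x] simplex_le_upper[OF assms(2), of "- x"]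
  by (simp add: hopf_oscillation_eq blinfun.minus_right)

section \<open>Disjoint extreme pairs\<close>

text \<open>A Jordan decomposition. The positive part \<open>\<nu>\<close> has to satisfy \<open>\<nu> \<le> upper\<close> and \<open>\<nu> - f \<le> upper\<close>, which is a
sandwich problem for \<open>upper\<close> and \<open>upper + f\<close>; its solvability condition is \<open>f x \<le> upper x + upper (- x)\<close>.
So the functionals dominated by the oscillation are precisely the differences of two elements of the
simplex.\<close>

lemma linear_le_hopf_decomposition:
  assumes f: "linear f" "f \<le> hopf_oscillation C e"
  obtains \<nu> \<pi> where "\<nu> \<in> abstract_simplex C e" "\<pi> \<in> abstract_simplex C e"
    "\<And>x. f x = \<nu> x - \<pi> x"
proof -
  have "sublinear (\<lambda>x. upper x + f x)"
    using sublinear_add[OF sublinear_upper] sublinear_scale[OF sublinear_upper]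
    by (intro sublinearI)
      (auto simp: linear_add[OF f(1)] linear_scale[OF f(1)] algebra_simps)
  moreover have "0 \<le> upper x + (upper (- x) + f (- x))" for x
    using le_funD[OF f(2), of x] by (simp add: linear_neg[OF f(1)] hopf_oscillation_eq)
  ultimately obtain g where g: "linear g" "g \<le> upper" "g \<le> (\<lambda>x. upper x + f x)"
    using sublinear_sandwich[OF sublinear_upper] by blast
  have "linear (\<lambda>x. g x - f x)" using g f by (intro linear_compose_sub)
  moreover have "(\<lambda>x. g x - f x) \<le> upper"
    using g(3) by (auto simp: le_fun_def algebra_simps)
  ultimately obtain \<pi> where \<pi>: "\<pi> \<in> abstract_simplex C e" "blinfun_apply \<pi> = (\<lambda>x. g x - f x)"
    using linear_le_upper_in_simplex by blast
  obtain \<nu> where \<nu>: "\<nu> \<in> abstract_simplex C e" "blinfun_apply \<nu> = g"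
    using linear_le_upper_in_simplex g by blast
  show ?thesis using that[OF \<nu>(1) \<pi>(1)] \<nu> \<pi> by simp
qed

lemma extreme_pointI:
  assumes x: "x \<in> S"
    and extr: "\<And>a b u. \<lbrakk>a \<in> S; b \<in> S; 0 < u; u < 1; x = (1 - u) *\<^sub>R a + u *\<^sub>R b\<rbrakk> \<Longrightarrow> a = x"
  shows "x extreme_point_of S"
  unfolding extreme_point_of_def
proof (intro conjI ballI notI)
  fix a b assume a: "a \<in> S" and b: "b \<in> S" and seg: "x \<in> open_segment a b"
  then obtain u where ab: "a \<noteq> b" and u: "0 < u" "u < 1" "x = (1 - u) *\<^sub>R a + u *\<^sub>R b"
    by (auto simp: in_segment)
  have "a = x" by (rule extr[OF a b u])
  moreover have "u *\<^sub>R (b - a) = x - a" using u(3) by (simp add: algebra_simps)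
  ultimately have "u *\<^sub>R (b - a) = 0" by simp
  then show False using ab u by simp
qed (rule x)

text \<open>Among the differences \<open>\<nu> - \<pi>\<close> of elements of the simplex an extreme one attains the
oscillation of \<open>y\<close>, and extremality of the difference passes to the pair. Moving \<open>\<nu>\<close> along a segment
of the simplex with \<open>\<pi>\<close> fixed moves the difference along a segment, so \<open>\<nu>\<close> is extreme, and likewise \<open>\<pi>\<close>.
If \<open>\<mu>\<close> dominates \<open>\<nu>/2\<close> and \<open>\<pi>/2\<close>, then \<open>a = 2\<mu> - \<nu>\<close> and \<open>b = 2\<mu> - \<pi>\<close> lie in the simplex and
\<open>\<nu> - \<pi> = b - a\<close> is the midpoint of \<open>\<nu> - a\<close> and \<open>b - \<pi>\<close>; extremality gives \<open>a = \<pi>\<close>, which is disjointness.\<close>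

lemma disjoint_extreme_pair_attains_hopf:
  obtains \<nu> \<pi> where "(\<nu>, \<pi>) \<in> disjoint_extreme_pairs C e" "\<nu> y - \<pi> y = hopf_oscillation C e y"
proof -
  obtain f where f: "linear f" "f \<le> hopf_oscillation C e" "f y = hopf_oscillation C e y"
    and extr: "\<And>g h u. \<lbrakk>linear g; linear h; g \<le> hopf_oscillation C e; h \<le> hopf_oscillation C e;
        0 < u; u < 1; \<And>x. f x = (1 - u) * g x + u * h x\<rbrakk> \<Longrightarrow> g = f"
    using extreme_support_functional[OF sublinear_hopf] by blast
  obtain \<nu> \<pi> where \<nu>: "\<nu> \<in> abstract_simplex C e" and \<pi>: "\<pi> \<in> abstract_simplex C e"
    and fx: "\<And>x. f x = \<nu> x - \<pi> x"
    using linear_le_hopf_decomposition[OF f(1,2)] by blast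
  have extr': "a - b = \<nu> - \<pi>"
    if ab: "a \<in> abstract_simplex C e" "b \<in> abstract_simplex C e"
      and cd: "c \<in> abstract_simplex C e" "d \<in> abstract_simplex C e"
      and u: "0 < u" "u < 1"
      and eq: "\<nu> - \<pi> = (1 - u) *\<^sub>R (a - b) + u *\<^sub>R (c - d)" for a b c d u
  proof -
    have "blinfun_apply (a - b) = f"
    proof (rule extr[OF _ _ _ _ u])
      show "linear (blinfun_apply (a - b))" "linear (blinfun_apply (c - d))"
        by (intro bounded_linear.linear blinfun.bounded_linear_right)+
      show "blinfun_apply (a - b) \<le> hopf_oscillation C e"
           "blinfun_apply (c - d) \<le> hopf_oscillation C e"
        using simplex_diff_le_hopf ab cd by (auto simp: le_fun_def blinfun.diff_left)
      show "f x = (1 - u) * (a - b) x + u * (c - d) x" for x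
        using arg_cong[OF eq, of "\<lambda>z. blinfun_apply z x"] fx[of x]
        by (simp add: blinfun.add_left blinfun.scaleR_left blinfun.diff_left)
    qed
    then show ?thesis using fx by (intro blinfun_eqI) (metis blinfun.diff_left)
  qed
  have "\<nu> extreme_point_of abstract_simplex C e"
  proof (rule extreme_pointI[OF \<nu>])
    fix a b u assume ab: "a \<in> abstract_simplex C e" "b \<in> abstract_simplex C e"
      and u: "0 < u" "u < 1" "\<nu> = (1 - u) *\<^sub>R a + u *\<^sub>R b"
    have "a - \<pi> = \<nu> - \<pi>"
      by (rule extr'[OF ab(1) \<pi> ab(2) \<pi> u(1,2)]) (simp add: u(3) algebra_simps)
    then show "a = \<nu>" by simp
  qed
  moreover have "\<pi> extreme_point_of abstract_simplex C e"
  proof (rule extreme_pointI[OF \<pi>])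
    fix a b u assume ab: "a \<in> abstract_simplex C e" "b \<in> abstract_simplex C e"
      and u: "0 < u" "u < 1" "\<pi> = (1 - u) *\<^sub>R a + u *\<^sub>R b"
    have "\<nu> - a = \<nu> - \<pi>"
      by (rule extr'[OF \<nu> ab(1) \<nu> ab(2) u(1,2)]) (simp add: u(3) algebra_simps)
    then show "a = \<pi>" by simp
  qed
  moreover have "disjoint_in_simplex C e \<nu> \<pi>"
    unfolding disjoint_in_simplex_def
  proof (intro conjI ballI impI \<nu> \<pi>)
    fix \<mu> assume \<mu>: "\<mu> \<in> abstract_simplex C e"
      and dom: "cone_le (dual_cone C) ((1/2) *\<^sub>R \<nu>) \<mu> \<and> cone_le (dual_cone C) ((1/2) *\<^sub>R \<pi>) \<mu>"
    have residual: "2 *\<^sub>R \<mu> - \<sigma> \<in> abstract_simplex C e"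
      if "\<sigma> \<in> abstract_simplex C e" "cone_le (dual_cone C) ((1/2) *\<^sub>R \<sigma>) \<mu>" for \<sigma>
      using that \<mu> unfolding abstract_simplex_def dual_cone_def cone_le_def
      by (auto simp: blinfun.diff_left blinfun.scaleR_left)
    have "\<nu> - (2 *\<^sub>R \<mu> - \<nu>) = \<nu> - \<pi>"
    proof (rule extr'[OF \<nu> residual[OF \<nu>] residual[OF \<pi>] \<pi>, of "1/2"])
      show "\<nu> - \<pi> = (1 - 1/2) *\<^sub>R (\<nu> - (2 *\<^sub>R \<mu> - \<nu>)) + (1/2) *\<^sub>R (2 *\<^sub>R \<mu> - \<pi> - \<pi>)"
        by (intro blinfun_eqI)
          (simp add: blinfun.diff_left blinfun.scaleR_left blinfun.add_left field_simps)
    qed (use dom in auto)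
    then have "2 *\<^sub>R \<mu> = \<nu> + \<pi>" by (simp add: algebra_simps)
    then have "(1/2) *\<^sub>R (2 *\<^sub>R \<mu>) = (1/2) *\<^sub>R (\<nu> + \<pi>)" by simp
    then show "\<mu> = (1/2) *\<^sub>R (\<nu> + \<pi>)" by simp
  qed
  ultimately have "(\<nu>, \<pi>) \<in> disjoint_extreme_pairs C e"
    by (simp add: disjoint_extreme_pairs_def extreme_points_def)
  then show ?thesis using that f(3) fx by metis
qed

lemma disjoint_extreme_pairs_simplex:
  "(\<nu>, \<pi>) \<in> disjoint_extreme_pairs C e \<Longrightarrow> \<nu> \<in> abstract_simplex C e \<and> \<pi> \<in> abstract_simplex C e"
  by (simp add: disjoint_extreme_pairs_def disjoint_in_simplex_def)

section \<open>The dual Thompson norm on differences of simplex elements\<close>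

lemma dual_norm_upper:
  assumes "\<nu> \<in> abstract_simplex C e" "\<pi> \<in> abstract_simplex C e" "thompson_norm C e x = 1"
  shows "(\<nu> - \<pi>) x \<le> thompson_dual_norm C e (\<nu> - \<pi>)"
  unfolding thompson_dual_norm_def
proof (rule cSUP_upper)
  have "(\<nu> - \<pi>) x \<le> 2" if "thompson_norm C e x = 1" for x
    using simplex_diff_le_hopf[OF assms(1,2), of x] hopf_le_thompson[of x] that
    by (simp add: blinfun.diff_left)
  then show "bdd_above ((\<lambda>x. (\<nu> - \<pi>) x) ` {x. thompson_norm C e x = 1})"
    by (intro bdd_aboveI[where M = 2]) auto
qed (use assms in simp)

lemma dual_norm_least:
  assumes "\<And>x. thompson_norm C e x = 1 \<Longrightarrow> blinfun_apply z x \<le> m"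
  shows "thompson_dual_norm C e z \<le> m"
  unfolding thompson_dual_norm_def by (rule cSUP_least) (use assms thompson_norm_unit in auto)

lemma dual_norm_nonneg:
  assumes "\<nu> \<in> abstract_simplex C e" "\<pi> \<in> abstract_simplex C e"
  shows "0 \<le> thompson_dual_norm C e (\<nu> - \<pi>)"
  using dual_norm_upper[OF assms thompson_norm_unit] simplex_unit assms
  by (simp add: blinfun.diff_left)

lemma dual_norm_le_2:
  assumes "\<nu> \<in> abstract_simplex C e" "\<pi> \<in> abstract_simplex C e"
  shows "thompson_dual_norm C e (\<nu> - \<pi>) \<le> 2"
proof (rule dual_norm_least)
  show "(\<nu> - \<pi>) x \<le> 2" if "thompson_norm C e x = 1" for x
    using simplex_diff_le_hopf[OF assms, of x] hopf_le_thompson[of x] that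
    by (simp add: blinfun.diff_left)
qed

text \<open>The difference \<open>\<nu> - \<pi>\<close> vanishes on the unit, so \<open>x\<close> can be shifted by a multiple of the unit before
the norm inequality is applied. The best shift centres \<open>x\<close> and makes its Thompson norm half of its
oscillation.\<close>

lemma diff_le_dual_norm_hopf:
  assumes "\<nu> \<in> abstract_simplex C e" "\<pi> \<in> abstract_simplex C e"
  shows "\<nu> x - \<pi> x \<le> thompson_dual_norm C e (\<nu> - \<pi>) * (hopf_oscillation C e x / 2)"
proof -
  let ?D = "thompson_dual_norm C e (\<nu> - \<pi>)"
  define t where "t = (upper x - upper (- x)) / 2"
  define w where "w = x - t *\<^sub>R e"
  have "upper (- w) = upper (- x) + t"
    using upper_shift[of "- x" "- t"] by (simp add: w_def)
  then have N: "thompson_norm C e w = hopf_oscillation C e x / 2"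
    unfolding thompson_norm_eq hopf_oscillation_eq
    using upper_shift[of x t] by (simp add: w_def t_def field_simps)
  have xw: "\<nu> x - \<pi> x = (\<nu> - \<pi>) w"
    using simplex_unit assms
    by (simp add: w_def blinfun.diff_left blinfun.diff_right blinfun.scaleR_right)
  have "(\<nu> - \<pi>) w \<le> ?D * thompson_norm C e w"
  proof (cases "thompson_norm C e w = 0")
    case False
    define n where "n = thompson_norm C e w"
    have n: "n > 0" using False thompson_norm_nonneg[of w] by (simp add: n_def)
    then have "thompson_norm C e ((1/n) *\<^sub>R w) = 1"
      using thompson_norm_scale[of "1/n" w] by (simp add: n_def)
    from dual_norm_upper[OF assms this] show ?thesis
      using n by (simp add: blinfun.scaleR_right n_def[symmetric] field_simps)
  qed (use thompson_norm_zero_imp[of w] in simp)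
  then show ?thesis using xw N by simp
qed

lemma dual_norm_pos:
  assumes "\<nu> \<in> abstract_simplex C e" "\<pi> \<in> abstract_simplex C e" "\<nu> \<noteq> \<pi>"
  shows "0 < thompson_dual_norm C e (\<nu> - \<pi>)"
proof (rule ccontr)
  assume "\<not> ?thesis"
  then have "thompson_dual_norm C e (\<nu> - \<pi>) = 0" using dual_norm_nonneg[OF assms(1,2)] by simp
  then have le: "\<nu> x - \<pi> x \<le> 0" for x
    using diff_le_dual_norm_hopf[OF assms(1,2), of x] by simp
  have "\<nu> x = \<pi> x" for x
    using le[of x] le[of "- x"] by (simp add: blinfun.minus_right)
  then show False using assms(3) blinfun_eqI by blast
qed

text \<open>The map from \<open>x\<close> to \<open>(e + x) / 2\<close> carries the Thompson unit ball \<open>[- e, e]\<close> onto \<open>[0, e]\<close>, and \<open>\<nu> - \<pi>\<close>, which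
vanishes on the unit, is halved by it. Hence the supremum of \<open>\<nu> - \<pi>\<close> over \<open>[0, e]\<close> is half its dual norm.\<close>

lemma INF_order_interval_eq_dual_norm:
  assumes \<nu>: "\<nu> \<in> abstract_simplex C e" and \<pi>: "\<pi> \<in> abstract_simplex C e"
  shows "(INF x\<in>order_interval C 0 e. ereal (\<pi> x + \<nu> (e - x)))
    = ereal (1 - thompson_dual_norm C e (\<nu> - \<pi>) / 2)" (is "_ = ereal (1 - ?D / 2)")
proof -
  have rew: "\<pi> x + \<nu> (e - x) = 1 - (\<nu> x - \<pi> x)" for x
    using simplex_unit[OF \<nu>] by (simp add: blinfun.diff_right)
  have "ereal (1 - ?D / 2) \<le> ereal (\<pi> x + \<nu> (e - x))" if x: "x \<in> order_interval C 0 e" for x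
  proof -
    have "upper x \<le> 1" "upper (- x) \<le> 0"
      using x by (auto simp: order_interval_def cone_le_def upper_le_iff)
    then have "hopf_oscillation C e x / 2 \<le> 1 / 2" by (simp add: hopf_oscillation_eq)
    then have "?D * (hopf_oscillation C e x / 2) \<le> ?D * (1 / 2)"
      by (intro mult_left_mono dual_norm_nonneg assms)
    then show ?thesis using diff_le_dual_norm_hopf[OF assms, of x] unfolding rew by simp
  qed
  moreover have "y \<le> ereal (1 - ?D / 2)"
    if y: "\<And>x. x \<in> order_interval C 0 e \<Longrightarrow> y \<le> ereal (\<pi> x + \<nu> (e - x))" for y
  proof -
    have "e \<in> order_interval C 0 e"
      using unit_in_cone scaled_unit_in_cone_iff[of 0] by (simp add: order_interval_def cone_le_def)
    from y[OF this] consider "y = - \<infinity>" | r where "y = ereal r" by (cases y) auto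
    then show ?thesis
    proof cases
      case (2 r)
      have "?D \<le> 2 * (1 - r)"
      proof (rule dual_norm_least)
        fix x assume "thompson_norm C e x = 1"
        then have "upper x \<le> 1" "upper (- x) \<le> 1" by (auto simp: thompson_norm_eq)
        then have "e - x \<in> C" "e + x \<in> C" by (auto simp: upper_le_iff)
        then have "(1/2) *\<^sub>R (e - x) \<in> C" "(1/2) *\<^sub>R (e + x) \<in> C" by (auto intro: cone_scale)
        moreover have "e - (1/2) *\<^sub>R (e + x) = (1/2) *\<^sub>R (e - x)"
          using scaleR_half_double[of e] by (simp add: algebra_simps)
        ultimately have "(1/2) *\<^sub>R (e + x) \<in> order_interval C 0 e"
          by (simp add: order_interval_def cone_le_def)
        from y[OF this] show "(\<nu> - \<pi>) x \<le> 2 * (1 - r)"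
          unfolding 2 rew using simplex_unit assms
          by (simp add: blinfun.diff_left blinfun.add_right blinfun.scaleR_right field_simps)
      qed
      then show ?thesis using 2 by simp
    qed simp
  qed
  ultimately show ?thesis by (intro INF_eqI) auto
qed

lemma dual_map_simplex:
  assumes "abstract_markov_operator C e T" "\<nu> \<in> abstract_simplex C e"
  shows "dual_map T \<nu> \<in> abstract_simplex C e"
  using assms by (auto simp: abstract_markov_operator_def abstract_simplex_def dual_cone_def dual_map_def)

end

section \<open>Contraction rates of a Markov operator\<close>


lemma Sup_nonneg_upper: "a \<in> A \<Longrightarrow> a \<le> Sup_nonneg A"
  by (auto simp: Sup_nonneg_def intro: Sup_upper)

lemma Sup_nonneg_least: "0 \<le> m \<Longrightarrow> (\<And>a. a \<in> A \<Longrightarrow> a \<le> m) \<Longrightarrow> Sup_nonneg A \<le> m"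
  by (auto simp: Sup_nonneg_def intro: Sup_least)

lemma Sup_nonneg_nonneg: "(\<And>a. a \<in> A \<Longrightarrow> 0 \<le> a) \<Longrightarrow> 0 \<le> Sup_nonneg A"
  by (auto simp: Sup_nonneg_def intro: Sup_upper2)

lemma dual_map_diff: "dual_map T (\<nu> - \<pi>) = dual_map T \<nu> - dual_map T \<pi>"
  by (intro blinfun_eqI) (simp add: dual_map_def blinfun.diff_left)

lemma dual_map_apply: "dual_map T \<nu> x = \<nu> (T x)"
  by (simp add: dual_map_def)

theorem theorem1p1:
  fixes C :: "'a::banach set" and e :: 'a and T :: "'a \<Rightarrow>\<^sub>L 'a"
  assumes nonzero: "\<exists>x::'a. x \<noteq> 0"
    and cone: "pointed_convex_cone C" and closed: "closed C" and normal: "normal_cone C"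
    and unit: "e \<in> interior C"
    and markov: "abstract_markov_operator C e T"
  shows "Sup_nonneg {ereal (hopf_oscillation C e (T z) / hopf_oscillation C e z) | z.
             hopf_oscillation C e z \<noteq> 0}
         = Sup_nonneg {ereal (thompson_dual_norm C e (dual_map T (\<nu> - \<pi>)) / thompson_dual_norm C e (\<nu> - \<pi>)) | \<nu> \<pi>.
             \<nu> \<in> abstract_simplex C e \<and> \<pi> \<in> abstract_simplex C e \<and> \<nu> \<noteq> \<pi>}
      \<and> Sup_nonneg {ereal (thompson_dual_norm C e (dual_map T (\<nu> - \<pi>)) / thompson_dual_norm C e (\<nu> - \<pi>)) | \<nu> \<pi>.
             \<nu> \<in> abstract_simplex C e \<and> \<pi> \<in> abstract_simplex C e \<and> \<nu> \<noteq> \<pi>}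
         = ereal (1/2) * Sup_nonneg {ereal (thompson_dual_norm C e (dual_map T \<nu> - dual_map T \<pi>)) | \<nu> \<pi>.
             (\<nu>, \<pi>) \<in> disjoint_extreme_pairs C e}
      \<and> ereal (1/2) * Sup_nonneg {ereal (thompson_dual_norm C e (dual_map T \<nu> - dual_map T \<pi>)) | \<nu> \<pi>.
             (\<nu>, \<pi>) \<in> disjoint_extreme_pairs C e}
         = 1 - (INF (\<nu>, \<pi>) \<in> disjoint_extreme_pairs C e. INF x \<in> order_interval C 0 e.
                  ereal (blinfun_apply \<pi> (T x) + blinfun_apply \<nu> (T (e - x))))"
proof -
  have "e \<noteq> 0"
  proof
    assume "e = 0"
    then obtain r where r: "r > 0" "cball 0 r \<subseteq> C" using unit mem_interior_cball by blast
    obtain x :: 'a where x: "x \<noteq> 0" using nonzero by blast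
    define v where "v = (r / norm x) *\<^sub>R x"
    have v: "v \<noteq> 0" "v \<in> C" "- v \<in> C"
      using r x by (auto simp: v_def intro!: subsetD[OF r(2)])
    then have "v \<in> C \<inter> uminus ` C" by (auto intro: image_eqI[of _ _ "- v"])
    then show False using cone v(1) unfolding pointed_convex_cone_def by blast
  qed
  then interpret order_unit_cone C e
    using cone closed unit by unfold_locales
  let ?h = "hopf_oscillation C e" and ?D = "thompson_dual_norm C e" and ?P = "abstract_simplex C e"
  let ?E = "disjoint_extreme_pairs C e"
  let ?A1 = "{ereal (?h (T z) / ?h z) | z. ?h z \<noteq> 0}"
  let ?A2 = "{ereal (?D (dual_map T (\<nu> - \<pi>)) / ?D (\<nu> - \<pi>)) | \<nu> \<pi>. \<nu> \<in> ?P \<and> \<pi> \<in> ?P \<and> \<nu> \<noteq> \<pi>}"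
  let ?A3 = "{ereal (?D (dual_map T \<nu> - dual_map T \<pi>)) | \<nu> \<pi>. (\<nu>, \<pi>) \<in> ?E}"
  note dual = dual_map_simplex[OF markov]
  have ET: "dual_map T \<nu> \<in> ?P \<and> dual_map T \<pi> \<in> ?P" if "(\<nu>, \<pi>) \<in> ?E" for \<nu> \<pi>
    using that disjoint_extreme_pairs_simplex dual by blast
  \<comment> \<open>Without a pair the outer infimum would be \<open>\<infinity>\<close>.\<close>
  obtain \<nu>0 \<pi>0 where E0: "(\<nu>0, \<pi>0) \<in> ?E"
    using disjoint_extreme_pair_attains_hopf by blast
  have A3: "0 \<le> Sup_nonneg ?A3" "Sup_nonneg ?A3 \<le> 2"
    using ET dual_norm_nonneg dual_norm_le_2
    by (auto intro!: Sup_nonneg_nonneg Sup_nonneg_least)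
  then obtain s where s: "Sup_nonneg ?A3 = ereal s" "0 \<le> s"
    by (cases "Sup_nonneg ?A3") auto
  have half_s: "ereal (1/2) * Sup_nonneg ?A3 = ereal (s / 2)" by (simp add: s)
  have s_upper: "?D (dual_map T \<nu> - dual_map T \<pi>) \<le> s" if "(\<nu>, \<pi>) \<in> ?E" for \<nu> \<pi>
  proof -
    have "ereal (?D (dual_map T \<nu> - dual_map T \<pi>)) \<le> Sup_nonneg ?A3"
      using that by (intro Sup_nonneg_upper) blast
    then show ?thesis by (simp add: s)
  qed
  have s_least: "s \<le> m"
    if m: "\<And>\<nu> \<pi>. (\<nu>, \<pi>) \<in> ?E \<Longrightarrow> ?D (dual_map T \<nu> - dual_map T \<pi>) \<le> m" for m
  proof -
    have "0 \<le> ?D (dual_map T \<nu>0 - dual_map T \<pi>0)" using ET[OF E0] dual_norm_nonneg by blast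
    then have "0 \<le> m" using m[OF E0] by linarith
    then have "Sup_nonneg ?A3 \<le> ereal m" using m by (intro Sup_nonneg_least) auto
    then show ?thesis by (simp add: s)
  qed

  \<comment> \<open>A disjoint extreme pair attains the oscillation of \<open>T z\<close>; the adjoint moves it to \<open>z\<close>.\<close>
  have 13: "Sup_nonneg ?A1 \<le> ereal (s / 2)"
  proof (rule Sup_nonneg_least)
    fix a assume "a \<in> ?A1"
    then obtain z where z: "a = ereal (?h (T z) / ?h z)" "?h z \<noteq> 0" by blast
    have pos: "0 < ?h z" using z(2) hopf_nonneg[of z] by linarith
    obtain \<nu> \<pi> where E: "(\<nu>, \<pi>) \<in> ?E" and att: "\<nu> (T z) - \<pi> (T z) = ?h (T z)"
      using disjoint_extreme_pair_attains_hopf by blast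
    have "?h (T z) \<le> ?D (dual_map T \<nu> - dual_map T \<pi>) * (?h z / 2)"
      using diff_le_dual_norm_hopf[of "dual_map T \<nu>" "dual_map T \<pi>" z] ET[OF E] att
      by (simp add: dual_map_apply)
    also have "\<dots> \<le> s * (?h z / 2)"
      using s_upper[OF E] pos by (intro mult_right_mono) auto
    finally show "a \<le> ereal (s / 2)" using pos by (simp add: z(1) field_simps)
  qed (use s in simp)

  have nonneg2: "0 \<le> Sup_nonneg ?A2"
    by (rule Sup_nonneg_nonneg)
      (auto simp: dual_map_diff intro!: divide_nonneg_nonneg dual_norm_nonneg dual)
  \<comment> \<open>Two elements of the simplex are at dual distance at most 2; this is the factor 1/2.\<close>
  have 32: "ereal (s / 2) \<le> Sup_nonneg ?A2"
  proof (cases "Sup_nonneg ?A2")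
    case (real c)
    have c: "0 \<le> c" using nonneg2 real by simp
    have "s \<le> 2 * c"
    proof (rule s_least)
      fix \<nu> \<pi> assume "(\<nu>, \<pi>) \<in> ?E"
      then have P: "\<nu> \<in> ?P" "\<pi> \<in> ?P" using disjoint_extreme_pairs_simplex by auto
      show "?D (dual_map T \<nu> - dual_map T \<pi>) \<le> 2 * c"
      \<comment> \<open>A point can be disjoint from itself: this is the case of a simplex with one point.\<close>
      proof (cases "\<nu> = \<pi>")
        case True
        have "?D (dual_map T \<nu> - dual_map T \<pi>) \<le> 0" unfolding True
          by (rule dual_norm_least) simp
        then show ?thesis using c by simp
      next
        case False
        have "ereal (?D (dual_map T (\<nu> - \<pi>)) / ?D (\<nu> - \<pi>)) \<le> Sup_nonneg ?A2"
          using P False by (intro Sup_nonneg_upper) blast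
        then have "?D (dual_map T (\<nu> - \<pi>)) \<le> c * ?D (\<nu> - \<pi>)"
          using dual_norm_pos[OF P False] real by (simp add: field_simps)
        also have "\<dots> \<le> c * 2" using dual_norm_le_2[OF P] c by (rule mult_left_mono)
        finally show ?thesis by (simp add: dual_map_diff mult.commute)
      qed
    qed
    then show ?thesis using real by simp
  qed (use nonneg2 in auto)

  have nonneg1: "0 \<le> Sup_nonneg ?A1"
    by (rule Sup_nonneg_nonneg) (auto intro!: divide_nonneg_nonneg hopf_nonneg)
  have 21: "Sup_nonneg ?A2 \<le> Sup_nonneg ?A1"
  proof (cases "Sup_nonneg ?A1")
    case (real c)
    have c: "0 \<le> c" using nonneg1 real by simp
    have contr: "?h (T x) \<le> c * ?h x" for x
    \<comment> \<open>Vectors of oscillation zero are multiples of the unit, which \<open>T\<close> fixes.\<close>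
    proof (cases "?h x = 0")
      case True
      then have "T x = upper x *\<^sub>R e"
        using hopf_zero_imp_scaled_unit[of x] markov
        by (metis abstract_markov_operator_def blinfun.scaleR_right)
      then show ?thesis using hopf_scaled_unit True by simp
    next
      case False
      have "ereal (?h (T x) / ?h x) \<le> Sup_nonneg ?A1"
        using False by (intro Sup_nonneg_upper) blast
      then show ?thesis using False hopf_nonneg[of x] real by (simp add: field_simps)
    qed
    have "Sup_nonneg ?A2 \<le> ereal c"
    proof (rule Sup_nonneg_least)
      fix a assume "a \<in> ?A2"
      then obtain \<nu> \<pi> where P: "\<nu> \<in> ?P" "\<pi> \<in> ?P" "\<nu> \<noteq> \<pi>"
        and a: "a = ereal (?D (dual_map T (\<nu> - \<pi>)) / ?D (\<nu> - \<pi>))" by blast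
      have pos: "0 < ?D (\<nu> - \<pi>)" by (rule dual_norm_pos[OF P])
      have "?D (dual_map T (\<nu> - \<pi>)) \<le> ?D (\<nu> - \<pi>) * c"
      proof (rule dual_norm_least)
        fix x assume x: "thompson_norm C e x = 1"
        have "c * ?h x \<le> c * 2" using hopf_le_thompson[of x] x c by (intro mult_left_mono) auto
        then have "?h (T x) / 2 \<le> c" using contr[of x] by linarith
        then have "?D (\<nu> - \<pi>) * (?h (T x) / 2) \<le> ?D (\<nu> - \<pi>) * c"
          using pos by (intro mult_left_mono) auto
        then show "dual_map T (\<nu> - \<pi>) x \<le> ?D (\<nu> - \<pi>) * c"
          using diff_le_dual_norm_hopf[OF P(1,2), of "T x"]
          by (simp add: dual_map_apply blinfun.diff_left)
      qed
      then show "a \<le> ereal c" using pos by (simp add: a field_simps)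
    qed (use c in simp)
    then show ?thesis using real by simp
  qed (use nonneg1 in auto)

  have "(INF (\<nu>, \<pi>) \<in> ?E. INF x \<in> order_interval C 0 e.
                  ereal (blinfun_apply \<pi> (T x) + blinfun_apply \<nu> (T (e - x)))) = ereal (1 - s / 2)"
  proof -
    let ?I = "\<lambda>\<nu> \<pi>. INF x \<in> order_interval C 0 e.
        ereal (blinfun_apply \<pi> (T x) + blinfun_apply \<nu> (T (e - x)))"
    have inner: "?I \<nu> \<pi>
        = ereal (1 - ?D (dual_map T \<nu> - dual_map T \<pi>) / 2)" if "(\<nu>, \<pi>) \<in> ?E" for \<nu> \<pi>
      using INF_order_interval_eq_dual_norm[of "dual_map T \<nu>" "dual_map T \<pi>"] ET[OF that]
      by (simp add: dual_map_apply)
    show ?thesis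
    proof (rule INF_eqI)
      show "ereal (1 - s / 2) \<le> (case p of (\<nu>, \<pi>) \<Rightarrow> ?I \<nu> \<pi>)" if "p \<in> ?E" for p
        using that s_upper inner by (cases p) auto
    next
      fix y assume "\<And>p. p \<in> ?E \<Longrightarrow> y \<le> (case p of (\<nu>, \<pi>) \<Rightarrow> ?I \<nu> \<pi>)"
      from this[of "(\<nu>, \<pi>)" for \<nu> \<pi>]
      have y: "y \<le> ereal (1 - ?D (dual_map T \<nu> - dual_map T \<pi>) / 2)" if "(\<nu>, \<pi>) \<in> ?E" for \<nu> \<pi>
        using that inner by auto
      from y[OF E0] consider "y = - \<infinity>" | r where "y = ereal r" by (cases y) auto
      then show "y \<le> ereal (1 - s / 2)"
      proof cases
        case (2 r)
        have "s \<le> 2 * (1 - r)"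
        proof (rule s_least)
          fix \<nu> \<pi> assume "(\<nu>, \<pi>) \<in> ?E"
          from y[OF this] show "?D (dual_map T \<nu> - dual_map T \<pi>) \<le> 2 * (1 - r)"
            unfolding 2 by simp
        qed
        then show ?thesis using 2 by simp
      qed simp
    qed
  qed
  then show ?thesis
    unfolding half_s using 13 32 21 by (auto simp: one_ereal_def)
qed

end
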